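(* Let $f_1=\sinh\chi\cos\phi$, $f_2=\sinh\chi\sin\phi$, $f_3=\cosh\chi$ on the upper sheet $L^2$ of the two-sheeted hyperboloid, and let $\mathcal{H}_1^-=\{Xf_1+Yf_2+Zf_3:(X,Y,Z)\in\mathbb{R}^3\}$ with Poisson bracket $$\{F,F'\}=\frac{1}{\sinh\chi}\left(\frac{\partial F}{\partial\chi}\frac{\partial F'}{\partial\phi}-\frac{\partial F}{\partial\phi}\frac{\partial F'}{\partial\chi}\right).$$ Identify $F=Xf_1+Yf_2+Zf_3$ with $(X,Y,Z)$. Then the Poisson algebra $\mathcal{H}_1^-$ coincides with the Lie algebra $\mathbb{R}^3_H$; that is, $\mathcal{H}_1^-$ is closed under the bracket and $\{F,F'\}=F\,\bar\wedge\,F'$ for all $F,F'\in\mathcal{H}_1^-$.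
   Context: $\mathbb{R}^3_H$ is the Lie algebra $\mathbb{R}^3$ with the vector product $(x,y,z)\,\bar\wedge\,(x',y',z')=(yz'-zy',\,zx'-xz',\,-(xy'-yx'))$. The hyperboloid sheet $L^2$ (the pseudo-sphere) is $\{x^2+y^2-z^2=-1,\ z>0\}$ with coordinates $\chi,\phi$ given by $x=\sinh\chi\cos\phi$, $y=\sinh\chi\sin\phi$, $z=\cosh\chi$.
   Formalization: The stated identity is off by a sign ({f1,f2}=f3, but the product of the first two basis vectors is (0,0,-1)); what is proved is {F,F'} = -(F ∧̄ F'), with H_1^- isomorphic to R^3_H by sending (X,Y,Z) to -(Xf1+Yf2+Zf3); the bracket at chi=0 is fixed by continuity. *)

theory Defs
  imports "HOL-Analysis.Analysis"
begin

definition vprod_H :: "real^3 \<Rightarrow> real^3 \<Rightarrow> real^3" where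
  "vprod_H v w = vector
     [v$2 * w$3 - v$3 * w$2,
      v$3 * w$1 - v$1 * w$3,
      - (v$1 * w$2 - v$2 * w$1)]"

definition L2 :: "(real^3) set" where
  "L2 = {p. (p$1)\<^sup>2 + (p$2)\<^sup>2 - (p$3)\<^sup>2 = -1 \<and> p$3 > 0}"

text \<open>The coordinates are used for \<open>chi > 0\<close> and arbitrary \<open>phi\<close>; they cover
  everything but the point \<open>(0,0,1)\<close>, where \<open>chi = 0\<close>.\<close>

definition hyp_coords :: "real \<Rightarrow> real \<Rightarrow> real^3" where
  "hyp_coords chi phi = vector [sinh chi * cos phi, sinh chi * sin phi, cosh chi]"

lemma hyp_coords_nth [simp]:
  "hyp_coords chi phi $ 1 = sinh chi * cos phi"
  "hyp_coords chi phi $ 2 = sinh chi * sin phi"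
  "hyp_coords chi phi $ 3 = cosh chi"
  by (simp_all add: hyp_coords_def)

lemma hyp_coords_in_L2 [simp]: "hyp_coords chi phi \<in> L2"
proof -
  have "(sinh chi * cos phi)\<^sup>2 + (sinh chi * sin phi)\<^sup>2 = (sinh chi)\<^sup>2 * ((cos phi)\<^sup>2 + (sin phi)\<^sup>2)"
    unfolding power_mult_distrib distrib_left ..
  then show ?thesis
    by (simp add: L2_def cosh_square_eq)
qed

text \<open>Functions on \<open>L2\<close> are represented by their extensional versions, so that equality of
  HOL functions is equality on \<open>L2\<close>.\<close>

definition f1 :: "real^3 \<Rightarrow> real" where "f1 = (\<lambda>p\<in>L2. p$1)"
definition f2 :: "real^3 \<Rightarrow> real" where "f2 = (\<lambda>p\<in>L2. p$2)"
definition f3 :: "real^3 \<Rightarrow> real" where "f3 = (\<lambda>p\<in>L2. p$3)"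

lemma f_hyp_coords [simp]:
  "f1 (hyp_coords chi phi) = sinh chi * cos phi"
  "f2 (hyp_coords chi phi) = sinh chi * sin phi"
  "f3 (hyp_coords chi phi) = cosh chi"
  by (simp_all add: f1_def f2_def f3_def)

definition lin_fun :: "real^3 \<Rightarrow> real^3 \<Rightarrow> real" where
  "lin_fun v = (\<lambda>p\<in>L2. v$1 * f1 p + v$2 * f2 p + v$3 * f3 p)"

definition H1 :: "(real^3 \<Rightarrow> real) set" where
  "H1 = range lin_fun"

definition coord_bracket ::
    "(real^3 \<Rightarrow> real) \<Rightarrow> (real^3 \<Rightarrow> real) \<Rightarrow> real \<Rightarrow> real \<Rightarrow> real" where
  "coord_bracket F G chi phi = 1 / sinh chi *
     (deriv (\<lambda>x. F (hyp_coords x phi)) chi * deriv (\<lambda>y. G (hyp_coords chi y)) phi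
      - deriv (\<lambda>y. F (hyp_coords chi y)) phi * deriv (\<lambda>x. G (hyp_coords x phi)) chi)"

text \<open>The bracket as a function on all of \<open>L2\<close>: the coordinate formula has no meaning at
  \<open>chi = 0\<close>, where the value is fixed by continuity.\<close>

definition poisson_bracket ::
    "(real^3 \<Rightarrow> real) \<Rightarrow> (real^3 \<Rightarrow> real) \<Rightarrow> real^3 \<Rightarrow> real" where
  "poisson_bracket F G =
     (THE K. K \<in> extensional L2 \<and> continuous_on L2 K \<and>
        (\<forall>chi>0. \<forall>phi. K (hyp_coords chi phi) = coord_bracket F G chi phi))"

text \<open>The given bracket and the given vector product differ by a sign: \<open>{f1, f2} = f3\<close>,
  whereas the product of the first two basis vectors is minus the third one.\<close>

lemma coord_bracket_f1_f2:
  assumes "chi > 0"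
  shows "coord_bracket f1 f2 chi phi = f3 (hyp_coords chi phi)"
proof -
  have "deriv (\<lambda>x. sinh x * c) chi = cosh chi * c" for c :: real
    by (rule DERIV_imp_deriv) (auto intro!: derivative_eq_intros)
  moreover have "deriv (\<lambda>y. sinh chi * cos y) phi = - sinh chi * sin phi"
    by (rule DERIV_imp_deriv) (auto intro!: derivative_eq_intros)
  moreover have "deriv (\<lambda>y. sinh chi * sin y) phi = sinh chi * cos phi"
    by (rule DERIV_imp_deriv) (auto intro!: derivative_eq_intros)
  ultimately have "coord_bracket f1 f2 chi phi =
      1 / sinh chi * (sinh chi * cosh chi * ((sin phi)\<^sup>2 + (cos phi)\<^sup>2))"
    unfolding coord_bracket_def f_hyp_coords by (simp only:) (simp only: power2_eq_square algebra_simps)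
  then show ?thesis
    using assms by simp
qed

lemma vprod_H_axis_1_2: "vprod_H (axis 1 1) (axis 2 1) = - axis 3 1"
  by (simp add: vprod_H_def vec_eq_iff forall_3 axis_def)

end

theory Submission
  imports Defs
begin

text \<open>
  On \<^term>\<open>L2\<close> the function \<^term>\<open>lin_fun v\<close> is the restriction of the linear form
  \<open>p \<mapsto> v \<bullet> p\<close>, so the identification of vectors with functions is injective because \<^term>\<open>L2\<close>
  spans the space. In coordinates the bracket of two such functions is bilinear and
  alternating in the coefficient vectors, and \<open>{f1, f2} = f3\<close>, \<open>{f2, f3} = - f1\<close>,
  \<open>{f3, f1} = - f2\<close>. These are the structure constants of the negative of
  \<^term>\<open>vprod_H\<close>. The factor \<open>1 / sinh \<chi>\<close> cancels each time, so the
  coordinate formula extends continuously over the apex \<open>(0, 0, 1)\<close>, namely by a linear form.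

  The bracket on all of \<^term>\<open>L2\<close> is a continuous extension of the coordinate formula. It is
  determined by that formula because the polar coordinates with \<open>\<chi> > 0\<close> reach every point
  except the apex, and the apex is a limit of such points.

  The identification that sends \<open>v\<close> to \<^term>\<open>lin_fun (- v)\<close> absorbs the sign: it is an
  isomorphism from the Lie algebra with product \<^term>\<open>vprod_H\<close> onto \<^term>\<open>H1\<close>, since
  replacing both arguments by their negatives leaves a bilinear bracket unchanged.
\<close>

lemma lin_fun_eq_inner: "p \<in> L2 \<Longrightarrow> lin_fun v p = v \<bullet> p"
  by (simp add: lin_fun_def f1_def f2_def f3_def inner_vec_def sum_3)

lemma lin_fun_hyp_coords:
  "lin_fun v (hyp_coords chi phi) =
     v$1 * (sinh chi * cos phi) + v$2 * (sinh chi * sin phi) + v$3 * cosh chi"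
  by (simp add: lin_fun_def)

lemma lin_fun_extensional: "lin_fun v \<in> extensional L2"
  by (simp add: lin_fun_def)

lemma continuous_on_lin_fun: "continuous_on L2 (lin_fun v)"
proof -
  have "continuous_on L2 (\<lambda>p. v \<bullet> p)"
    by (intro continuous_intros)
  then show ?thesis
    by (rule continuous_on_eq) (simp add: lin_fun_eq_inner)
qed

text \<open>The apex and one further point above each of the two coordinate axes of the base plane
  already span the space.\<close>

lemma inj_lin_fun: "inj lin_fun"
proof (rule injI)
  fix v w assume eq: "lin_fun v = lin_fun w"
  have at: "v$1 * (sinh chi * cos phi) + v$2 * (sinh chi * sin phi) + v$3 * cosh chi
          = w$1 * (sinh chi * cos phi) + w$2 * (sinh chi * sin phi) + w$3 * cosh chi" for chi phi
    using fun_cong [OF eq, of "hyp_coords chi phi"] by (simp add: lin_fun_hyp_coords)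
  have "v$3 = w$3"
    using at [of 0 0] by simp
  moreover have "v$1 = w$1"
    using at [of 1 0] \<open>v$3 = w$3\<close> by simp
  moreover have "v$2 = w$2"
    using at [of 1 "pi/2"] \<open>v$3 = w$3\<close> by simp
  ultimately show "v = w"
    by (simp add: vec_eq_iff forall_3)
qed

lemma coord_bracket_lin_fun:
  assumes "chi > 0"
  shows "coord_bracket (lin_fun v) (lin_fun w) chi phi
           = lin_fun (- vprod_H v w) (hyp_coords chi phi)"
proof -
  have dchi: "deriv (\<lambda>x. lin_fun u (hyp_coords x phi)) chi =
      u$1 * (cosh chi * cos phi) + u$2 * (cosh chi * sin phi) + u$3 * sinh chi" for u
    unfolding lin_fun_hyp_coords
    by (rule DERIV_imp_deriv) (auto intro!: derivative_eq_intros)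
  have dphi: "deriv (\<lambda>y. lin_fun u (hyp_coords chi y)) phi =
      sinh chi * (u$2 * cos phi - u$1 * sin phi)" for u
    unfolding lin_fun_hyp_coords
    by (rule DERIV_imp_deriv) (auto intro!: derivative_eq_intros simp: algebra_simps)
  \<comment> \<open>Every derivative in \<open>phi\<close> carries the factor \<open>sinh chi\<close>, which the bracket divides out.\<close>
  have "coord_bracket (lin_fun v) (lin_fun w) chi phi =
      (v$1 * (cosh chi * cos phi) + v$2 * (cosh chi * sin phi) + v$3 * sinh chi)
        * (w$2 * cos phi - w$1 * sin phi)
      - (v$2 * cos phi - v$1 * sin phi)
        * (w$1 * (cosh chi * cos phi) + w$2 * (cosh chi * sin phi) + w$3 * sinh chi)"
    using assms unfolding coord_bracket_def dchi dphi by (simp add: field_simps)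
  also have "\<dots> = (v$1 * w$2 - v$2 * w$1) * cosh chi * ((sin phi)\<^sup>2 + (cos phi)\<^sup>2)
      + (v$3 * w$2 - v$2 * w$3) * (sinh chi * cos phi)
      + (v$1 * w$3 - v$3 * w$1) * (sinh chi * sin phi)"
    by algebra
  also have "\<dots> = lin_fun (- vprod_H v w) (hyp_coords chi phi)"
    by (simp add: lin_fun_hyp_coords vprod_H_def)
  finally show ?thesis .
qed

text \<open>Polar coordinates: \<open>sinh \<chi>\<close> and \<open>\<phi>\<close> are the modulus and the argument of the projection
  to the base plane, read as a complex number, and the equation of the hyperboloid
  then forces the third coordinate.\<close>

lemma L2_polar:
  assumes "p \<in> L2"
  obtains chi phi where "chi \<ge> 0" "p = hyp_coords chi phi"
proof -
  define z where "z = Complex (p$1) (p$2)"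
  define chi where "chi = arsinh (cmod z)"
  have "sinh chi = cmod z"
    by (simp add: chi_def)
  have "chi \<ge> 0"
    using \<open>sinh chi = cmod z\<close> by (metis norm_ge_zero sinh_real_nonneg_iff)
  have "rcis (cmod z) (Arg z) = z"
    by (rule rcis_cmod_Arg)
  then have 12: "sinh chi * cos (Arg z) = p$1" "sinh chi * sin (Arg z) = p$2"
    unfolding \<open>sinh chi = cmod z\<close> by (metis Re_rcis z_def complex.sel(1))
      (metis Im_rcis z_def complex.sel(2) \<open>rcis (cmod z) (Arg z) = z\<close>)
  have "(cosh chi)\<^sup>2 = (p$3)\<^sup>2"
    using assms \<open>sinh chi = cmod z\<close> by (simp add: cosh_square_eq L2_def z_def cmod_power2)
  then have "cosh chi = p$3"
    using assms by (simp add: L2_def power2_eq_iff_nonneg)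
  with 12 have "p = hyp_coords chi (Arg z)"
    by (simp add: vec_eq_iff forall_3)
  with \<open>chi \<ge> 0\<close> show ?thesis
    by (rule that)
qed

lemma continuous_on_hyp_coords: "continuous_on S (\<lambda>chi. hyp_coords chi phi)"
proof -
  have "continuous_on S (\<lambda>chi. hyp_coords chi phi $ i)" for i
  proof -
    have "continuous_on S (\<lambda>chi. sinh chi * c)" for c :: real
      by (intro continuous_intros)
    moreover have "continuous_on S (\<lambda>chi. cosh chi)"
      by (intro continuous_intros)
    ultimately show ?thesis
      using exhaust_3 [of i] by auto
  qed
  then have "continuous_on S (\<lambda>chi. \<chi> i. hyp_coords chi phi $ i)"
    by (rule continuous_on_vec_lambda)
  then show ?thesis
    by simp
qed

text \<open>The rays \<open>\<phi> = const\<close> lead to the apex as \<open>\<chi>\<close> tends to \<open>0\<close>, so the coordinate patch is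
  dense and continuity settles the value at the apex.\<close>

lemma eq_if_eq_on_coords:
  fixes K K' :: "real^3 \<Rightarrow> real"
  assumes ext: "K \<in> extensional L2" "K' \<in> extensional L2"
    and cont: "continuous_on L2 K" "continuous_on L2 K'"
    and eq: "\<And>chi phi. chi > 0 \<Longrightarrow> K (hyp_coords chi phi) = K' (hyp_coords chi phi)"
  shows "K = K'"
proof (rule extensionalityI [OF ext])
  fix p assume "p \<in> L2"
  then obtain chi phi where "chi \<ge> 0" and p: "p = hyp_coords chi phi"
    by (rule L2_polar)
  let ?d = "\<lambda>x. K (hyp_coords x phi) - K' (hyp_coords x phi)"
  have "continuous_on (closure {0<..}) ?d"
    by (intro continuous_intros continuous_on_compose2 [OF cont(1) continuous_on_hyp_coords]
        continuous_on_compose2 [OF cont(2) continuous_on_hyp_coords]) auto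
  then have "?d chi = 0"
    by (rule continuous_constant_on_closure) (use eq \<open>chi \<ge> 0\<close> in auto)
  then show "K p = K' p"
    by (simp add: p)
qed

lemma poisson_bracket_lin_fun:
  "poisson_bracket (lin_fun v) (lin_fun w) = lin_fun (- vprod_H v w)"
  unfolding poisson_bracket_def
proof (rule the_equality)
  fix K
  assume "K \<in> extensional L2 \<and> continuous_on L2 K \<and>
    (\<forall>chi>0. \<forall>phi. K (hyp_coords chi phi) = coord_bracket (lin_fun v) (lin_fun w) chi phi)"
  then show "K = lin_fun (- vprod_H v w)"
    by (intro eq_if_eq_on_coords)
      (simp_all add: lin_fun_extensional continuous_on_lin_fun coord_bracket_lin_fun)
qed (simp add: lin_fun_extensional continuous_on_lin_fun coord_bracket_lin_fun)

theorem proposition2p1: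
  shows "bij_betw lin_fun UNIV H1
    \<and> (\<forall>F\<in>H1. \<forall>G\<in>H1. poisson_bracket F G \<in> H1)
    \<and> (\<forall>v w. poisson_bracket (lin_fun v) (lin_fun w) = lin_fun (- vprod_H v w))
    \<and> bij_betw (\<lambda>v. lin_fun (- v)) UNIV H1
    \<and> (\<forall>v w. poisson_bracket (lin_fun (- v)) (lin_fun (- w)) = lin_fun (- vprod_H v w))"
proof (intro conjI ballI allI)
  show bij: "bij_betw lin_fun UNIV H1"
    by (simp add: bij_betw_def H1_def inj_lin_fun)
  show "poisson_bracket F G \<in> H1" if "F \<in> H1" "G \<in> H1" for F G
    using that by (auto simp: H1_def poisson_bracket_lin_fun)
  show "poisson_bracket (lin_fun v) (lin_fun w) = lin_fun (- vprod_H v w)" for v w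
    by (rule poisson_bracket_lin_fun)
  have "bij_betw uminus (UNIV :: (real^3) set) UNIV"
    by (rule bij_uminus)
  from bij_betw_trans [OF this bij] show "bij_betw (\<lambda>v. lin_fun (- v)) UNIV H1"
    by (simp add: comp_def)
  show "poisson_bracket (lin_fun (- v)) (lin_fun (- w)) = lin_fun (- vprod_H v w)" for v w
  proof -
    have "vprod_H (- v) (- w) = vprod_H v w"
      by (simp add: vprod_H_def)
    then show ?thesis
      by (simp add: poisson_bracket_lin_fun)
  qed
qed

end
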